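(* Let $C$ be a nonempty closed convex subset of a real Hilbert space $H$. Let $T:C\to C$ be a nonexpansive mapping with $F(T)\ne\emptyset$. Suppose $\{\alpha_n\}_{n\ge0}$ is a real sequence in $[0,1]$ with $\lim_{n\to\infty}\alpha_n=1$. Let $x_0\in C$ be arbitrary and let $\{x_n\}$ be generated, for $n\ge0$, by $$y_n=(1-\alpha_n)x_0+\alpha_nTx_n,$$ $$C_n=\{z\in C:\|y_n-z\|^2\le\|x_n-z\|^2+2(1-\alpha_n)\langle x_n-x_0,z\rangle+\theta_n\},$$ $$Q_n=\{z\in C:\langle z-x_n,x_n-x_0\rangle\ge0\},$$ $$x_{n+1}=P_{C_n^*\cap Q_n}x_0,$$ where $C_n^*$ is a closed convex set with $F(T)\subset C_n^*\subset C_n$ and $$\theta_n=(1-\alpha_n)(\|x_0\|^2-\|x_n\|^2)-\alpha_n(1-\alpha_n)\|x_0-Tx_n\|^2.$$ Then $\{x_n\}$ converges strongly to $P_{F(T)}x_0$.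
   Context: $F(T)=\{x\in C:Tx=x\}$. $T$ is nonexpansive if $\|Tx-Ty\|\le\|x-y\|$ for all $x,y\in C$. For a nonempty closed convex set $D\subset H$, $P_D$ is the metric projection (nearest-point map) onto $D$. *)

theory Defs
  imports "HOL-Analysis.Analysis"
begin

definition fixed_points :: "'a set \<Rightarrow> ('a \<Rightarrow> 'a) \<Rightarrow> 'a set" where
  "fixed_points C T = {x \<in> C. T x = x}"

definition nonexpansive_on :: "'a::real_normed_vector set \<Rightarrow> ('a \<Rightarrow> 'a) \<Rightarrow> bool" where
  "nonexpansive_on C T \<longleftrightarrow> (\<forall>x\<in>C. \<forall>y\<in>C. norm (T x - T y) \<le> norm (x - y))"

(* The library's closest_point requires a Heine-Borel space, which excludes
   infinite-dimensional Hilbert spaces.  The value is meaningful when the nearest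
   point exists and is unique, in particular for D nonempty, closed and convex in
   a Hilbert space. *)
definition metric_proj :: "'a::real_normed_vector set \<Rightarrow> 'a \<Rightarrow> 'a" where
  "metric_proj D x = (THE p. p \<in> D \<and> (\<forall>z\<in>D. norm (x - p) \<le> norm (x - z)))"

end

theory Submission
  imports Defs
begin

text \<open>Let \<open>F\<close> be the fixed point set and \<open>p\<close> its point nearest to \<open>x 0\<close>. The proof shows that
  the iterates stay no farther from \<open>x 0\<close> than \<open>p\<close> while their displacement under \<open>T\<close> tends to
  zero, and that any sequence in \<open>C\<close> with these two properties converges to \<open>p\<close>.

  The second half is a statement about nonexpansive maps alone
  (\<open>nearest_fixed_point_attracts\<close>). Midpoints of almost fixed points are almost fixed
  (\<open>norm_sq_image_midpoint_diff_le\<close>), so almost fixed points behave like points of a convex set, and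
  the classical proof that minimising sequences in a convex set are Cauchy carries over
  (\<open>almost_minimal_almost_fixed_points_close\<close>). It yields a fixed point whose distance from \<open>x 0\<close>
  cannot be undercut even in the limit by almost fixed points; almost fixed points that do not
  exceed this distance must converge to it. Strong convergence is obtained without passing through
  weak limits. For the identity map the same result is the projection theorem for closed convex
  sets, which makes the iteration well defined.

  For the first half, \<open>Q n\<close> is \<open>C\<close> cut by a half space whose boundary passes through \<open>x n\<close>
  (and is all of \<open>C\<close> when \<open>x n = x 0\<close>). By the
  variational inequality for projections it contains every point of the set onto which \<open>x 0\<close> was
  projected to get \<open>x n\<close>; by induction all of these sets contain \<open>F\<close>, so the iterates are no
  farther from \<open>x 0\<close> than \<open>p\<close>. Since \<open>x (Suc n)\<close> lies in \<open>Q n\<close>, the distances to \<open>x 0\<close> increase and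
  consecutive iterates approach each other (\<open>outward_steps_tend_to_zero\<close>). Since \<open>x (Suc n)\<close> also
  lies in \<open>Cn n\<close>, whose defining inequality is \<open>norm (y n - z) \<le> norm (x n - z)\<close> up to terms with
  the factor \<open>1 - \<alpha> n\<close>, the point \<open>y n\<close> approaches \<open>x (Suc n)\<close>, and therefore \<open>T (x n)\<close>
  approaches \<open>x n\<close>.\<close>

section \<open>Midpoints of almost fixed points\<close>

text \<open>The parallelogram law, in the form in which it turns a lower bound for the distance from
  \<open>c\<close> to a midpoint into an upper bound for the distance between the end points.\<close>

lemma midpoint_norm_sq:
  fixes u v c :: "'a::real_inner"
  shows "4 * (norm (c - midpoint u v))\<^sup>2 + (norm (u - v))\<^sup>2
           = 2 * (norm (c - u))\<^sup>2 + 2 * (norm (c - v))\<^sup>2"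
  by (simp add: midpoint_def power2_norm_eq_inner inner_simps inner_commute algebra_simps)

text \<open>The set of points moved by at most \<open>e\<close> need not be convex, but its midpoints are still
  moved little. The point \<open>T m\<close> is at distance at most \<open>norm (u - v) / 2 + e\<close> from both \<open>u\<close> and
  \<open>v\<close>, and in a Hilbert space the two balls of that radius meet only near the midpoint.\<close>

lemma norm_sq_image_midpoint_diff_le:
  fixes T :: "'a::real_inner \<Rightarrow> 'a"
  assumes "convex C" "nonexpansive_on C T"
    and u: "u \<in> C" "norm (T u - u) \<le> e" and v: "v \<in> C" "norm (T v - v) \<le> e"
  shows "(norm (T (midpoint u v) - midpoint u v))\<^sup>2 \<le> e * (norm (u - v) + e)"
proof -
  define m where "m = midpoint u v"
  have mC: "m \<in> C"
    using closed_segment_subset[OF u(1) v(1) \<open>convex C\<close>] midpoint_in_closed_segment[of u v]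
    unfolding m_def by blast
  have half: "norm (m - u) = norm (u - v) / 2" "norm (m - v) = norm (u - v) / 2"
    using dist_midpoint[of u v] by (auto simp: m_def dist_norm norm_minus_commute)
  have bound: "norm (T m - w) \<le> norm (u - v) / 2 + e"
    if "w \<in> C" "norm (T w - w) \<le> e" "norm (m - w) = norm (u - v) / 2" for w
  proof -
    have "norm (T m - w) \<le> norm (T m - T w) + norm (T w - w)"
      using norm_triangle_ineq[of "T m - T w" "T w - w"] by simp
    also have "norm (T m - T w) \<le> norm (m - w)"
      using assms(2) mC that(1) by (auto simp: nonexpansive_on_def)
    finally show ?thesis using that by simp
  qed
  have "4 * (norm (T m - m))\<^sup>2 + (norm (u - v))\<^sup>2
          = 2 * (norm (T m - u))\<^sup>2 + 2 * (norm (T m - v))\<^sup>2"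
    unfolding m_def by (rule midpoint_norm_sq)
  also have "\<dots> \<le> 4 * (norm (u - v) / 2 + e)\<^sup>2"
    using power_mono[OF bound[OF u half(1)], of 2] power_mono[OF bound[OF v half(2)], of 2]
    by simp
  finally show ?thesis
    unfolding m_def by (simp add: power2_eq_square field_simps)
qed

text \<open>Uniqueness of nearest fixed points in quantitative form. The hypothesis on \<open>D\<close> says that no
  number below \<open>D\<close> is the limit of squared distances from \<open>a\<close> to points whose displacement under
  \<open>T\<close> tends to zero. The midpoint of two almost fixed points is almost fixed, so it cannot be much
  nearer to \<open>a\<close> than \<open>sqrt D\<close>; if both end points are not much farther, the parallelogram law
  forces them together. Working with squared distances avoids a separate treatment of small \<open>D\<close>.\<close>

lemma almost_minimal_almost_fixed_points_close:
  fixes T :: "'a::real_inner \<Rightarrow> 'a"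
  assumes "convex C" "nonexpansive_on C T" "D \<ge> 0"
    and low: "\<And>d. d < D \<Longrightarrow> \<exists>e>0. \<forall>w\<in>C. norm (T w - w) \<le> e \<longrightarrow> d < (norm (a - w))\<^sup>2"
    and "\<eta> > 0"
  obtains e where "e > 0"
    "\<And>u v. \<lbrakk>u \<in> C; norm (T u - u) \<le> e; (norm (a - u))\<^sup>2 \<le> D + e;
             v \<in> C; norm (T v - v) \<le> e; (norm (a - v))\<^sup>2 \<le> D + e\<rbrakk> \<Longrightarrow> norm (u - v) < \<eta>"
proof -
  define \<delta> where "\<delta> = \<eta>\<^sup>2 / 16"
  have \<delta>: "\<delta> > 0" using \<open>\<eta> > 0\<close> by (simp add: \<delta>_def)
  obtain e0 where e0: "e0 > 0"
    "\<And>w. w \<in> C \<Longrightarrow> norm (T w - w) \<le> e0 \<Longrightarrow> D - \<delta> < (norm (a - w))\<^sup>2"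
    using low[of "D - \<delta>"] \<delta> by auto
  \<comment> \<open>The distance between \<open>u\<close> and \<open>v\<close> below is at most \<open>4 * D + 5\<close>, so this choice
    makes the displacement of their midpoint at most \<open>e0\<close>.\<close>
  define e where "e = min 1 (min \<delta> (e0\<^sup>2 / (4 * D + 6)))"
  have e: "e > 0" "e \<le> 1" "e \<le> \<delta>" "e * (4 * D + 6) \<le> e0\<^sup>2"
  proof -
    show "e > 0" using \<delta> e0(1) \<open>D \<ge> 0\<close> by (simp add: e_def)
    show "e \<le> 1" "e \<le> \<delta>" by (auto simp: e_def)
    have "e \<le> e0\<^sup>2 / (4 * D + 6)" by (simp add: e_def)
    then show "e * (4 * D + 6) \<le> e0\<^sup>2"
      using \<open>D \<ge> 0\<close> by (simp add: pos_le_divide_eq)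
  qed
  show ?thesis
  proof (rule that[OF e(1)])
    fix u v
    assume u: "u \<in> C" "norm (T u - u) \<le> e" "(norm (a - u))\<^sup>2 \<le> D + e"
      and v: "v \<in> C" "norm (T v - v) \<le> e" "(norm (a - v))\<^sup>2 \<le> D + e"
    define m where "m = midpoint u v"
    have mC: "m \<in> C"
      using closed_segment_subset[OF u(1) v(1) \<open>convex C\<close>] midpoint_in_closed_segment[of u v]
      unfolding m_def by blast
    have par: "4 * (norm (a - m))\<^sup>2 + (norm (u - v))\<^sup>2 \<le> 4 * (D + e)"
      using midpoint_norm_sq[of a u v, folded m_def] u(3) v(3) by argo
    have "norm (u - v) \<le> 4 * D + 5"
    proof -
      have "(norm (u - v))\<^sup>2 \<le> 4 * D + 4"
        using par e(2) zero_le_power2[of "norm (a - m)"] by argo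
      moreover have "2 * norm (u - v) \<le> 1 + (norm (u - v))\<^sup>2"
        using zero_le_power2[of "norm (u - v) - 1"] by (simp add: power2_diff)
      ultimately show ?thesis using \<open>D \<ge> 0\<close> by linarith
    qed
    then have "e * (norm (u - v) + e) \<le> e * (4 * D + 6)"
      using e by (intro mult_left_mono) auto
    then have "(norm (T m - m))\<^sup>2 \<le> e0\<^sup>2"
      using norm_sq_image_midpoint_diff_le[OF assms(1,2) u(1,2) v(1,2), folded m_def] e(4) by linarith
    then have "norm (T m - m) \<le> e0"
      using e0(1) by (simp add: power2_le_iff_abs_le)
    then have "D - \<delta> < (norm (a - m))\<^sup>2"
      using e0(2) mC by blast
    then have "(norm (u - v))\<^sup>2 < 8 * \<delta>"
      using par e(3) by argo
    also have "\<dots> \<le> \<eta>\<^sup>2" by (simp add: \<delta>_def)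
    finally show "norm (u - v) < \<eta>"
      using \<open>\<eta> > 0\<close> by (meson less_imp_le power_less_imp_less_base)
  qed
qed

section \<open>The nearest fixed point\<close>

text \<open>The limit of almost fixed points that nearly minimise the distance to \<open>a\<close> exists by
  completeness, and it is a fixed point whose distance from \<open>a\<close> is minimal not only among fixed
  points but among all limits of distances along almost fixed points. This stronger minimality
  gives the last claim: a sequence of almost fixed points that is no farther from \<open>a\<close> than \<open>q\<close>
  is itself nearly minimising and hence close to \<open>q\<close>. The usual argument extracts a weakly
  convergent subsequence and applies demiclosedness of \<open>I - T\<close>; this lemma replaces both.\<close>

lemma nearest_fixed_point_attracts:
  fixes C :: "'a::{real_inner, complete_space} set" and T :: "'a \<Rightarrow> 'a"
  assumes "closed C" "convex C" "nonexpansive_on C T" "fixed_points C T \<noteq> {}"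
  obtains q where "q \<in> fixed_points C T"
    "\<And>z. z \<in> fixed_points C T \<Longrightarrow> norm (a - q) \<le> norm (a - z)"
    "\<And>w. \<lbrakk>\<And>n. w n \<in> C; (\<lambda>n. T (w n) - w n) \<longlonglongrightarrow> 0; \<And>n. norm (a - w n) \<le> norm (a - q)\<rbrakk>
           \<Longrightarrow> w \<longlonglongrightarrow> q"
proof -
  \<comment> \<open>\<open>D\<close> is the least squared distance from \<open>a\<close> that points of arbitrarily
    small displacement can approach; a priori it might be smaller than the squared distance to the fixed points.\<close>
  define P where "P d \<longleftrightarrow> (\<forall>e>0. \<exists>w\<in>C. norm (T w - w) \<le> e \<and> (norm (a - w))\<^sup>2 \<le> d)" for d
  define D where "D = Inf {d. P d}"
  have P_fixed: "P ((norm (a - z))\<^sup>2)" if "z \<in> fixed_points C T" for z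
    using that unfolding P_def fixed_points_def by force
  have P_nonneg: "d \<ge> 0" if "P d" for d
    using that zero_less_one unfolding P_def by (metis order_trans zero_le_power2)
  then have bdd: "bdd_below {d. P d}" by (auto intro!: bdd_belowI[of _ 0])
  have ne: "{d. P d} \<noteq> {}" using P_fixed assms(4) by blast
  have D0: "D \<ge> 0" unfolding D_def using ne P_nonneg by (intro cInf_greatest) auto
  have D_le: "D \<le> (norm (a - z))\<^sup>2" if "z \<in> fixed_points C T" for z
    unfolding D_def using bdd P_fixed[OF that] by (intro cInf_lower) auto
  have low: "\<exists>e>0. \<forall>w\<in>C. norm (T w - w) \<le> e \<longrightarrow> d < (norm (a - w))\<^sup>2" if "d < D" for d
  proof -
    have "\<not> P d" using that cInf_lower[OF _ bdd, of d] unfolding D_def by auto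
    then show ?thesis unfolding P_def by (meson not_le)
  qed
  note close = almost_minimal_almost_fixed_points_close[OF assms(2,3) D0 low]
  have "\<exists>w\<in>C. norm (T w - w) \<le> e \<and> (norm (a - w))\<^sup>2 \<le> D + e" if "e > 0" for e
  proof -
    obtain d where "P d" "d < D + e"
      using cInf_lessD[OF ne, of "D + e"] \<open>e > 0\<close> unfolding D_def by auto
    then show ?thesis using that unfolding P_def by (meson less_imp_le order_trans)
  qed
  then have "\<forall>k. \<exists>w\<in>C. norm (T w - w) \<le> inverse (real (Suc k))
                 \<and> (norm (a - w))\<^sup>2 \<le> D + inverse (real (Suc k))"
    by simp
  then obtain z where zC: "\<And>k. z k \<in> C"
    and zT: "\<And>k. norm (T (z k) - z k) \<le> inverse (real (Suc k))"
    and za: "\<And>k. (norm (a - z k))\<^sup>2 \<le> D + inverse (real (Suc k))"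
    by metis
  have "Cauchy z"
  proof (rule metric_CauchyI)
    fix \<eta> :: real assume "\<eta> > 0"
    then obtain e where e: "e > 0"
      "\<And>u v. \<lbrakk>u \<in> C; norm (T u - u) \<le> e; (norm (a - u))\<^sup>2 \<le> D + e;
             v \<in> C; norm (T v - v) \<le> e; (norm (a - v))\<^sup>2 \<le> D + e\<rbrakk> \<Longrightarrow> norm (u - v) < \<eta>"
      using close by metis
    obtain N where N: "inverse (real (Suc N)) < e" using reals_Archimedean[OF e(1)] by auto
    have small: "inverse (real (Suc k)) \<le> e" if "k \<ge> N" for k
    proof -
      have "inverse (real (Suc k)) \<le> inverse (real (Suc N))"
        using that by (intro le_imp_inverse_le) auto
      then show ?thesis using N by linarith
    qed
    have "dist (z k) (z l) < \<eta>" if "k \<ge> N" "l \<ge> N" for k l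
      unfolding dist_norm
      using small[OF that(1)] small[OF that(2)] zT[of k] zT[of l] za[of k] za[of l]
      by (intro e(2) zC) linarith+
    then show "\<exists>M. \<forall>m\<ge>M. \<forall>n\<ge>M. dist (z m) (z n) < \<eta>" by blast
  qed
  then obtain q where q: "z \<longlonglongrightarrow> q"
    using Cauchy_convergent convergent_def by blast
  have qC: "q \<in> C" using closed_sequentially[OF assms(1)] zC q by blast
  have "(\<lambda>k. T (z k)) \<longlonglongrightarrow> T q"
  proof (rule metric_tendsto_imp_tendsto[OF q])
    show "\<forall>\<^sub>F k in sequentially. dist (T (z k)) (T q) \<le> dist (z k) q"
      using assms(3) zC qC by (auto simp: nonexpansive_on_def dist_norm)
  qed
  moreover have "(\<lambda>k. T (z k)) \<longlonglongrightarrow> q"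
  proof -
    have "(\<lambda>k. T (z k) - z k) \<longlonglongrightarrow> 0"
      by (rule Lim_null_comparison[OF _ LIMSEQ_inverse_real_of_nat]) (use zT in auto)
    from tendsto_add[OF this q] show ?thesis by simp
  qed
  ultimately have qF: "q \<in> fixed_points C T"
    using LIMSEQ_unique qC by (auto simp: fixed_points_def)
  have qD: "(norm (a - q))\<^sup>2 \<le> D"
  proof (rule LIMSEQ_le)
    show "(\<lambda>k. (norm (a - z k))\<^sup>2) \<longlonglongrightarrow> (norm (a - q))\<^sup>2" by (intro tendsto_intros q)
    show "(\<lambda>k. D + inverse (real (Suc k))) \<longlonglongrightarrow> D"
      using tendsto_add[OF tendsto_const LIMSEQ_inverse_real_of_nat, of D] by simp
  qed (use za in auto)
  show ?thesis
  proof (rule that[OF qF])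
    show "norm (a - q) \<le> norm (a - p)" if "p \<in> fixed_points C T" for p
      using qD D_le[OF that] by (meson norm_ge_zero order_trans power2_le_imp_le)
  next
    fix w assume wC: "\<And>n. w n \<in> C" and w0: "(\<lambda>n. T (w n) - w n) \<longlonglongrightarrow> 0"
      and wa: "\<And>n. norm (a - w n) \<le> norm (a - q)"
    show "w \<longlonglongrightarrow> q"
    proof (rule tendstoI)
      fix \<eta> :: real assume "\<eta> > 0"
      then obtain e where e: "e > 0"
        "\<And>u v. \<lbrakk>u \<in> C; norm (T u - u) \<le> e; (norm (a - u))\<^sup>2 \<le> D + e;
               v \<in> C; norm (T v - v) \<le> e; (norm (a - v))\<^sup>2 \<le> D + e\<rbrakk> \<Longrightarrow> norm (u - v) < \<eta>"
        using close by metis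
      have "\<forall>\<^sub>F n in sequentially. norm (T (w n) - w n) < e"
        using tendstoD[OF w0 e(1)] by simp
      then show "\<forall>\<^sub>F n in sequentially. dist (w n) q < \<eta>"
      proof eventually_elim
        case (elim n)
        have "(norm (a - w n))\<^sup>2 \<le> D + e"
          using power_mono[OF wa[of n] norm_ge_zero, of 2] qD e(1) by linarith
        moreover have "T q = q" using qF by (simp add: fixed_points_def)
        ultimately show ?case
          unfolding dist_norm using elim qD e(1) by (intro e(2) wC qC) auto
      qed
    qed
  qed
qed

text \<open>The attraction property also shows that the nearest fixed point is unique: a second one,
  taken as a constant sequence, would have to converge to the first. Hence the description by
  \<open>THE\<close> in \<open>metric_proj\<close> denotes it.\<close>

lemma nearest_fixed_point_is_metric_proj:
  fixes C :: "'a::{real_inner, complete_space} set" and T :: "'a \<Rightarrow> 'a"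
  assumes "closed C" "convex C" "nonexpansive_on C T" "fixed_points C T \<noteq> {}"
  shows "metric_proj (fixed_points C T) a \<in> fixed_points C T"
    and "z \<in> fixed_points C T \<Longrightarrow> norm (a - metric_proj (fixed_points C T) a) \<le> norm (a - z)"
    and "\<lbrakk>\<And>n. w n \<in> C; (\<lambda>n. T (w n) - w n) \<longlonglongrightarrow> 0;
          \<And>n. norm (a - w n) \<le> norm (a - metric_proj (fixed_points C T) a)\<rbrakk>
         \<Longrightarrow> w \<longlonglongrightarrow> metric_proj (fixed_points C T) a"
proof -
  obtain q where q: "q \<in> fixed_points C T"
    "\<And>z. z \<in> fixed_points C T \<Longrightarrow> norm (a - q) \<le> norm (a - z)"
    and attracts: "\<And>w. \<lbrakk>\<And>n. w n \<in> C; (\<lambda>n. T (w n) - w n) \<longlonglongrightarrow> 0;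
       \<And>n. norm (a - w n) \<le> norm (a - q)\<rbrakk> \<Longrightarrow> w \<longlonglongrightarrow> q"
  proof (rule nearest_fixed_point_attracts[OF assms, of a], goal_cases)
    case (1 q)
    show ?case by (rule 1(1); fact 1)
  qed
  have "p = q" if p: "p \<in> fixed_points C T" "norm (a - p) \<le> norm (a - q)" for p
  proof -
    have "(\<lambda>_::nat. p) \<longlonglongrightarrow> q"
      using p by (intro attracts) (auto simp: fixed_points_def)
    then show ?thesis by (simp add: LIMSEQ_const_iff)
  qed
  then have "metric_proj (fixed_points C T) a = q"
    unfolding metric_proj_def using q by (intro the_equality) auto
  then show "metric_proj (fixed_points C T) a \<in> fixed_points C T"
    and "z \<in> fixed_points C T \<Longrightarrow> norm (a - metric_proj (fixed_points C T) a) \<le> norm (a - z)"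
    and "\<lbrakk>\<And>n. w n \<in> C; (\<lambda>n. T (w n) - w n) \<longlonglongrightarrow> 0;
          \<And>n. norm (a - w n) \<le> norm (a - metric_proj (fixed_points C T) a)\<rbrakk>
         \<Longrightarrow> w \<longlonglongrightarrow> metric_proj (fixed_points C T) a"
    using q attracts by auto
qed

text \<open>The projection theorem is the case of the identity map, which fixes every point. The last
  part is the variational inequality characterising projections.\<close>

lemma metric_proj_closed_convex:
  fixes D :: "'a::{real_inner, complete_space} set"
  assumes "closed D" "convex D" "D \<noteq> {}"
  shows "metric_proj D a \<in> D"
    and "z \<in> D \<Longrightarrow> norm (a - metric_proj D a) \<le> norm (a - z)"
    and "z \<in> D \<Longrightarrow> inner (z - metric_proj D a) (metric_proj D a - a) \<ge> 0"
proof -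
  have all_fixed: "fixed_points D (\<lambda>x. x) = D" and ne: "nonexpansive_on D (\<lambda>x. x)"
    by (auto simp: fixed_points_def nonexpansive_on_def)
  note proj = nearest_fixed_point_is_metric_proj[OF assms(1,2) ne, unfolded all_fixed, OF assms(3)]
  show mem: "metric_proj D a \<in> D" by (rule proj(1))
  show nearest: "norm (a - metric_proj D a) \<le> norm (a - z)" if "z \<in> D" for z
    using that by (rule proj(2))
  show "inner (z - metric_proj D a) (metric_proj D a - a) \<ge> 0" if "z \<in> D"
  proof -
    have "inner (a - metric_proj D a) (z - metric_proj D a) \<le> 0"
      by (rule any_closest_point_dot[OF assms(2,1) mem that]) (auto simp: dist_norm nearest)
    then show ?thesis
      by (simp add: inner_diff_left inner_diff_right inner_commute)
  qed
qed

section \<open>The hybrid iteration\<close>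

text \<open>The steps make an obtuse angle with the direction back to \<open>a\<close>, so by Pythagoras the squared
  length of a step is at most the increase of the squared distance to \<open>a\<close>. These distances are
  increasing and bounded, so the increments tend to zero.\<close>

lemma outward_steps_tend_to_zero:
  fixes x :: "nat \<Rightarrow> 'a::real_inner"
  assumes outward: "\<And>n. inner (x (Suc n) - x n) (x n - a) \<ge> 0"
    and bounded: "\<And>n. norm (x n - a) \<le> B"
  shows "(\<lambda>n. x (Suc n) - x n) \<longlonglongrightarrow> 0"
proof -
  define r where "r n = (norm (x n - a))\<^sup>2" for n
  have step: "(norm (x (Suc n) - x n))\<^sup>2 \<le> r (Suc n) - r n" for n
    using outward[of n]
    by (simp add: r_def power2_norm_eq_inner inner_diff_left inner_diff_right inner_commute)
  have "incseq r"
    using step by (intro incseq_SucI) (meson diff_ge_0_iff_ge order_trans zero_le_power2)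
  moreover have "r n \<le> B\<^sup>2" for n
    unfolding r_def using bounded[of n] by (intro power_mono) auto
  ultimately obtain L where "r \<longlonglongrightarrow> L"
    using incseq_convergent by blast
  from tendsto_diff[OF LIMSEQ_Suc[OF this] this]
  have "(\<lambda>n. r (Suc n) - r n) \<longlonglongrightarrow> 0" by simp
  then have "(\<lambda>n. (norm (x (Suc n) - x n))\<^sup>2) \<longlonglongrightarrow> 0"
    by (rule Lim_null_comparison[rotated]) (use step in auto)
  then have "(\<lambda>n. sqrt ((norm (x (Suc n) - x n))\<^sup>2)) \<longlonglongrightarrow> sqrt 0"
    by (rule tendsto_real_sqrt)
  then show ?thesis by (simp add: tendsto_norm_zero_iff)
qed

lemma tendsto_zero_mult_bounded:
  fixes f g :: "nat \<Rightarrow> real"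
  assumes "f \<longlonglongrightarrow> 0" and "\<And>n. \<bar>g n\<bar> \<le> B"
  shows "(\<lambda>n. f n * g n) \<longlonglongrightarrow> 0"
proof (rule Lim_null_comparison)
  show "\<forall>\<^sub>F n in sequentially. norm (f n * g n) \<le> \<bar>f n\<bar> * B"
    using assms(2) by (intro always_eventually allI) (simp add: abs_mult mult_left_mono)
  show "(\<lambda>n. \<bar>f n\<bar> * B) \<longlonglongrightarrow> 0"
    using tendsto_mult_left_zero[OF tendsto_rabs_zero[OF assms(1)]] .
qed

theorem theorem7p4:
  fixes C :: "'a::{real_inner, complete_space} set"
    and T :: "'a \<Rightarrow> 'a"
    and \<alpha> \<theta> :: "nat \<Rightarrow> real"
    and x y :: "nat \<Rightarrow> 'a"
    and Cn Cs Q :: "nat \<Rightarrow> 'a set"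
  assumes "C \<noteq> {}" and "closed C" and "convex C"
    and "T ` C \<subseteq> C"
    and "nonexpansive_on C T"
    and "fixed_points C T \<noteq> {}"
    and "\<And>n. \<alpha> n \<in> {0..1}"
    and "\<alpha> \<longlonglongrightarrow> 1"
    and "x 0 \<in> C"
    and "\<And>n. y n = (1 - \<alpha> n) *\<^sub>R x 0 + \<alpha> n *\<^sub>R T (x n)"
    and "\<And>n. \<theta> n = (1 - \<alpha> n) * ((norm (x 0))\<^sup>2 - (norm (x n))\<^sup>2)
                    - \<alpha> n * (1 - \<alpha> n) * (norm (x 0 - T (x n)))\<^sup>2"
    and "\<And>n. Cn n = {z \<in> C. (norm (y n - z))\<^sup>2
                    \<le> (norm (x n - z))\<^sup>2 + 2 * (1 - \<alpha> n) * inner (x n - x 0) z + \<theta> n}"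
    and "\<And>n. Q n = {z \<in> C. inner (z - x n) (x n - x 0) \<ge> 0}"
    and "\<And>n. closed (Cs n)" and "\<And>n. convex (Cs n)"
    and "\<And>n. fixed_points C T \<subseteq> Cs n" and "\<And>n. Cs n \<subseteq> Cn n"
    and "\<And>n. x (Suc n) = metric_proj (Cs n \<inter> Q n) (x 0)"
  shows "x \<longlonglongrightarrow> metric_proj (fixed_points C T) (x 0)"
proof -
  note C = assms(2,3) and ne = assms(5) and F_ne = assms(6) and \<alpha>01 = assms(7)
    and x0 = assms(9) and y = assms(10) and \<theta> = assms(11) and Cn = assms(12) and Q = assms(13)
    and Cs_closed = assms(14) and Cs_convex = assms(15) and F_Cs = assms(16)
    and Cs_Cn = assms(17) and xSuc = assms(18)
  define F where "F = fixed_points C T"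
  define p where "p = metric_proj F (x 0)"
  have pF: "p \<in> F"
    unfolding p_def F_def by (rule nearest_fixed_point_is_metric_proj(1)[OF C ne F_ne])
  then have pC: "p \<in> C" and Tp: "T p = p" by (auto simp: F_def fixed_points_def)

  have Q_eq: "Q n = C \<inter> {z. inner (x n - x 0) z \<ge> inner (x n - x 0) (x n)}" for n
    unfolding Q by (auto simp: inner_diff_left inner_diff_right inner_commute)
  have CQ: "closed (Cs n \<inter> Q n)" "convex (Cs n \<inter> Q n)" for n
    unfolding Q_eq using C Cs_closed[of n] Cs_convex[of n]
    by (auto intro!: closed_Int convex_Int closed_halfspace_ge convex_halfspace_ge)

  \<comment> \<open>The inclusion for \<open>n\<close> is what makes the next projection well defined, and its
    variational inequality is the inclusion for \<open>Suc n\<close>.\<close>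
  have F_Q: "F \<subseteq> Q n" for n
  proof (induction n)
    case 0
    show ?case by (auto simp: F_def fixed_points_def Q)
  next
    case (Suc n)
    have F_CQ: "F \<subseteq> Cs n \<inter> Q n" using Suc F_Cs[of n] by (auto simp: F_def)
    then have "Cs n \<inter> Q n \<noteq> {}" using pF by auto
    from metric_proj_closed_convex(3)[OF CQ this, of _ "x 0"] F_CQ
    have "inner (z - x (Suc n)) (x (Suc n) - x 0) \<ge> 0" if "z \<in> F" for z
      using that unfolding xSuc by blast
    then show ?case by (auto simp: Q[of "Suc n"] F_def fixed_points_def)
  qed
  have F_CQ: "F \<subseteq> Cs n \<inter> Q n" for n using F_Q[of n] F_Cs[of n] by (auto simp: F_def)
  then have CQ_ne: "Cs n \<inter> Q n \<noteq> {}" for n using pF by blast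
  have x_in: "x (Suc n) \<in> Cs n \<inter> Q n" for n
    unfolding xSuc by (rule metric_proj_closed_convex(1)[OF CQ CQ_ne])
  have xC: "x n \<in> C" for n
    using x0 x_in by (cases n) (auto simp: Q)
  have x_near: "norm (x 0 - x n) \<le> norm (x 0 - p)" for n
  proof (cases n)
    case (Suc m)
    show ?thesis unfolding Suc xSuc
      by (rule metric_proj_closed_convex(2)[OF CQ CQ_ne]) (use F_CQ pF in auto)
  qed simp

  have step: "(\<lambda>n. x (Suc n) - x n) \<longlonglongrightarrow> 0"
  proof (rule outward_steps_tend_to_zero)
    show "inner (x (Suc n) - x n) (x n - x 0) \<ge> 0" for n using x_in[of n] by (simp add: Q)
    show "norm (x n - x 0) \<le> norm (x 0 - p)" for n using x_near[of n] by (simp add: norm_minus_commute)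
  qed

  define M where "M = norm (x 0) + norm (x 0 - p)"
  define R where "R = 3 * norm (x 0 - p)"
  have x_bd: "norm (x n) \<le> M" for n
    using norm_triangle_ineq2[of "x n" "x 0"] x_near[of n] norm_minus_commute[of "x n" "x 0"]
    by (simp add: M_def)
  have Tx_bd: "norm (x 0 - T (x n)) \<le> R" for n
  proof -
    have "norm (x 0 - T (x n)) \<le> norm (x 0 - p) + norm (p - T (x n))"
      using norm_triangle_ineq[of "x 0 - p" "p - T (x n)"] by simp
    moreover have "norm (p - T (x n)) \<le> norm (p - x n)"
      using ne pC xC[of n] Tp unfolding nonexpansive_on_def by metis
    moreover have "norm (p - x n) \<le> norm (x 0 - p) + norm (x 0 - x n)"
      using norm_triangle_ineq4[of "x 0 - x n" "x 0 - p"] by simp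
    ultimately show ?thesis using x_near[of n] by (simp add: R_def)
  qed
  have \<alpha>0: "(\<lambda>n. 1 - \<alpha> n) \<longlonglongrightarrow> 0"
    using tendsto_diff[OF tendsto_const assms(8), of 1] by simp

  \<comment> \<open>All terms in the inequality defining \<open>Cn n\<close>, at \<open>z = x (Suc n)\<close>, that carry the
    vanishing factor \<open>1 - \<alpha> n\<close>.\<close>
  define g where "g n = 2 * inner (x n - x 0) (x (Suc n)) + ((norm (x 0))\<^sup>2 - (norm (x n))\<^sup>2)
      - \<alpha> n * (norm (x 0 - T (x n)))\<^sup>2" for n
  have g_bd: "\<bar>g n\<bar> \<le> 2 * (norm (x 0 - p) * M) + M\<^sup>2 + R\<^sup>2" for n
  proof -
    have "\<bar>inner (x n - x 0) (x (Suc n))\<bar> \<le> norm (x n - x 0) * norm (x (Suc n))"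
      by (rule Cauchy_Schwarz_ineq2)
    also have "\<dots> \<le> norm (x 0 - p) * M"
      using x_near[of n] x_bd[of "Suc n"] by (intro mult_mono) (auto simp: norm_minus_commute)
    finally have 1: "\<bar>inner (x n - x 0) (x (Suc n))\<bar> \<le> norm (x 0 - p) * M" .
    have 2: "(norm (x k))\<^sup>2 \<le> M\<^sup>2" for k using x_bd[of k] by (intro power_mono) auto
    have "(norm (x 0 - T (x n)))\<^sup>2 \<le> R\<^sup>2" using Tx_bd[of n] by (intro power_mono) auto
    then have 3: "\<alpha> n * (norm (x 0 - T (x n)))\<^sup>2 \<le> R\<^sup>2" "0 \<le> \<alpha> n * (norm (x 0 - T (x n)))\<^sup>2"
      using \<alpha>01[of n] mult_left_le_one_le[of "(norm (x 0 - T (x n)))\<^sup>2" "\<alpha> n"] by auto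
    show ?thesis
      using 1 2[of 0] 2[of n] 3 zero_le_power2[of "norm (x 0)"] zero_le_power2[of "norm (x n)"]
      unfolding g_def by linarith
  qed
  have y_sq: "(norm (y n - x (Suc n)))\<^sup>2 \<le> (norm (x (Suc n) - x n))\<^sup>2 + (1 - \<alpha> n) * g n" for n
  proof -
    have "x (Suc n) \<in> Cn n" using x_in[of n] Cs_Cn[of n] by auto
    then show ?thesis
      unfolding Cn \<theta> g_def by (simp add: norm_minus_commute[of "x n"] algebra_simps)
  qed
  have "(\<lambda>n. (norm (x (Suc n) - x n))\<^sup>2 + (1 - \<alpha> n) * g n) \<longlonglongrightarrow> 0"
    using tendsto_add[OF tendsto_power[OF tendsto_norm_zero[OF step], of 2]
        tendsto_zero_mult_bounded[OF \<alpha>0 g_bd]] by simp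
  then have "(\<lambda>n. (norm (y n - x (Suc n)))\<^sup>2) \<longlonglongrightarrow> 0"
    by (rule Lim_null_comparison[rotated]) (use y_sq in auto)
  then have "(\<lambda>n. sqrt ((norm (y n - x (Suc n)))\<^sup>2)) \<longlonglongrightarrow> sqrt 0"
    by (rule tendsto_real_sqrt)
  then have yx: "(\<lambda>n. y n - x (Suc n)) \<longlonglongrightarrow> 0" by (simp add: tendsto_norm_zero_iff)
  have Ty: "(\<lambda>n. (1 - \<alpha> n) *\<^sub>R (x 0 - T (x n))) \<longlonglongrightarrow> 0"
  proof (rule tendsto_norm_zero_cancel)
    have "(\<lambda>n. (1 - \<alpha> n) * norm (x 0 - T (x n))) \<longlonglongrightarrow> 0"
      by (rule tendsto_zero_mult_bounded[OF \<alpha>0, where B = R]) (use Tx_bd in auto)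
    then show "(\<lambda>n. norm ((1 - \<alpha> n) *\<^sub>R (x 0 - T (x n)))) \<longlonglongrightarrow> 0"
      using \<alpha>01 by simp
  qed
  have decomp: "(y n - x (Suc n)) + (x (Suc n) - x n) - (1 - \<alpha> n) *\<^sub>R (x 0 - T (x n)) = T (x n) - x n" for n
    unfolding y by (simp add: algebra_simps)
  have Tx: "(\<lambda>n. T (x n) - x n) \<longlonglongrightarrow> 0"
    using tendsto_diff[OF tendsto_add[OF yx step] Ty] unfolding decomp by simp

  show ?thesis
    by (rule nearest_fixed_point_is_metric_proj(3)[OF C ne F_ne xC Tx])
      (use x_near in \<open>simp add: p_def F_def\<close>)
qed

end
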